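(* Let $w_0$ be an arbitrary number, let $(a_{n,j})$ (with $n\in\mathbb{N}$, $0\leqslant j\leqslant n-1$) be an arbitrary family of numbers, and let $w_n=\sum_{j=0}^{n-1}a_{n,j}w_j$ for $n\in\mathbb{N}=\{1,2,3,\dots\}$. Then for every $n\in\mathbb{N}$, $$ \sum_{j=0}^n w_j=w_0\sum_{\mathtt{v}\in\mathbb{V}_n}\ \prod_{k=1}^{|\mathtt{v}|}a_{(\mathtt{v})_k,\,(\mathtt{v})_{k-1}},\qquad\text{with the convention } (\mathtt{v})_0=0, $$ where $\mathbb{V}_n$ is the set of all finite strictly increasing vectors $\mathtt{v}$ of integers with entries in $\{1,\dots,n\}$, i.e. $1\leqslant (\mathtt{v})_1<(\mathtt{v})_2<\cdots<(\mathtt{v})_{|\mathtt{v}|}\leqslant n$, including the empty vector.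
   Context: "Number" means complex number. For a finite vector $\mathtt{v}$, $|\mathtt{v}|$ denotes its length and $(\mathtt{v})_k$ its $k$th element (indices starting at $1$). The empty vector has length $0$, and the empty product equals $1$. *)

theory Defs
  imports Complex_Main
begin

definition incr_vectors :: "nat \<Rightarrow> nat list set" where
  "incr_vectors n = {v. set v \<subseteq> {1..n} \<and> sorted_wrt (<) v}"

(* The sum over incr_vectors n is a genuine finite sum. *)
lemma finite_incr_vectors: "finite (incr_vectors n)"
  by (rule finite_subset[OF _ finite_subset_distinct[of "{1..n}"]])
    (auto simp: incr_vectors_def strict_sorted_iff)

(* 1-based k-th entry of v, with the convention that the 0-th entry is 0;
   only used for k <= length v. *)
definition entry :: "nat list \<Rightarrow> nat \<Rightarrow> nat" where
  "entry v k = (if k = 0 then 0 else v ! (k - 1))"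

end

theory Submission
  imports Defs
begin

text \<open>
  Unfolding the recursion for \<open>w m\<close> all the way down to \<open>w 0\<close> produces one product of coefficients
  for every descending chain of indices from \<open>m\<close> to \<open>0\<close>. Read backwards, such a chain is an
  increasing vector whose last entry is \<open>m\<close>, so \<open>w m\<close> is \<open>w0\<close> times the total weight of the
  increasing vectors ending in \<open>m\<close> (lemma \<open>recursion_eq_weight_sum\<close>). By the convention on
  the zeroth entry, the empty vector ends in \<open>0\<close> and accounts for \<open>w 0\<close>. Every increasing vector with
  entries up to \<open>n\<close> ends in exactly one \<open>m \<le> n\<close>, so summing over \<open>m\<close> gives the claim.

  The formula for \<open>w m\<close> follows by strong induction: deleting the final entry \<open>m\<close> leaves an arbitrary
  increasing vector with entries up to \<open>m - 1\<close>, and if that vector ends in \<open>j\<close>, the deletion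
  removes precisely the factor \<open>a m j\<close> from the weight.
\<close>

definition last_entry :: "nat list \<Rightarrow> nat" where
  "last_entry v = entry v (length v)"

definition weight :: "(nat \<Rightarrow> nat \<Rightarrow> 'a::comm_semiring_1) \<Rightarrow> nat list \<Rightarrow> 'a" where
  "weight a v = (\<Prod>k=1..length v. a (entry v k) (entry v (k - 1)))"

text \<open>
  The last entry bounds all the others, so this is also the set of vectors ending in \<open>j\<close> inside
  \<open>incr_vectors n\<close> for every \<open>n \<ge> j\<close>: the fibres of \<open>last_entry\<close> stay the same as \<open>n\<close> grows.
\<close>
definition vectors_ending_in :: "nat \<Rightarrow> nat list set" where
  "vectors_ending_in j = {v \<in> incr_vectors j. last_entry v = j}"

lemma last_entry_Nil [simp]: "last_entry [] = 0"
  by (simp add: last_entry_def entry_def)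

lemma last_entry_snoc [simp]: "last_entry (v @ [m]) = m"
  by (simp add: last_entry_def entry_def)

lemma weight_Nil [simp]: "weight a [] = 1"
  by (simp add: weight_def)

lemma entry_append: "k \<le> length v \<Longrightarrow> entry (v @ u) k = entry v k"
  by (auto simp: entry_def nth_append)

lemma weight_snoc: "weight a (v @ [m]) = a m (last_entry v) * weight a v"
proof -
  have "(\<Prod>k=1..length v. a (entry (v @ [m]) k) (entry (v @ [m]) (k - 1))) = weight a v"
    unfolding weight_def by (intro prod.cong) (auto simp: entry_append)
  moreover have "entry (v @ [m]) (Suc (length v)) = m"
    by (simp add: entry_def)
  ultimately show ?thesis
    by (simp add: weight_def prod.nat_ivl_Suc' entry_append last_entry_def mult.commute)
qed

lemma snoc_in_incr_vectors_iff:
  "v @ [m] \<in> incr_vectors n \<longleftrightarrow> v \<in> incr_vectors (m - 1) \<and> 1 \<le> m \<and> m \<le> n"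
  by (fastforce simp: incr_vectors_def sorted_wrt_append)

lemma Nil_in_incr_vectors [simp]: "[] \<in> incr_vectors n"
  by (simp add: incr_vectors_def)

lemma last_entry_le: "v \<in> incr_vectors n \<Longrightarrow> last_entry v \<le> n"
  by (cases v rule: rev_cases) (auto simp: snoc_in_incr_vectors_iff)

lemma incr_vectors_fibre:
  assumes "j \<le> n"
  shows "{v \<in> incr_vectors n. last_entry v = j} = vectors_ending_in j"
proof -
  have "v \<in> incr_vectors n \<and> last_entry v = j \<longleftrightarrow> v \<in> incr_vectors j \<and> last_entry v = j" for v
    using assms by (cases v rule: rev_cases) (auto simp: snoc_in_incr_vectors_iff)
  then show ?thesis
    by (auto simp: vectors_ending_in_def)
qed

lemma sum_incr_vectors_by_last_entry:
  "(\<Sum>v\<in>incr_vectors n. f v) = (\<Sum>j=0..n. \<Sum>v\<in>vectors_ending_in j. f v)"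
proof -
  have "(\<Sum>v\<in>incr_vectors n. f v) = (\<Sum>j=0..n. \<Sum>v\<in>{v \<in> incr_vectors n. last_entry v = j}. f v)"
    by (rule sum.group[symmetric]) (auto simp: finite_incr_vectors last_entry_le)
  then show ?thesis
    by (simp add: incr_vectors_fibre)
qed

lemma vectors_ending_in_0: "vectors_ending_in 0 = {[]}"
  by (auto simp: vectors_ending_in_def incr_vectors_def)

lemma vectors_ending_in_pos:
  assumes "m \<ge> 1"
  shows "vectors_ending_in m = (\<lambda>v. v @ [m]) ` incr_vectors (m - 1)"
proof -
  have "v \<in> vectors_ending_in m \<longleftrightarrow> v \<in> (\<lambda>v. v @ [m]) ` incr_vectors (m - 1)" for v
    using assms
    by (cases v rule: rev_cases) (auto simp: vectors_ending_in_def snoc_in_incr_vectors_iff)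
  then show ?thesis
    by blast
qed

text \<open>
  Since the vectors ending in \<open>m\<close> arise by appending \<open>m\<close>, which costs a factor depending on the
  shorter vector only through its last entry, their total weight obeys the same recursion as \<open>w\<close>.
\<close>
lemma weight_sum_recursion:
  assumes "m \<ge> 1"
  shows "(\<Sum>v\<in>vectors_ending_in m. weight a v)
    = (\<Sum>j=0..m-1. a m j * (\<Sum>v\<in>vectors_ending_in j. weight a v))"
proof -
  have "(\<Sum>v\<in>vectors_ending_in m. weight a v) = (\<Sum>v\<in>incr_vectors (m - 1). weight a (v @ [m]))"
    by (simp add: vectors_ending_in_pos[OF assms] sum.reindex inj_on_def)
  also have "\<dots> = (\<Sum>j=0..m-1. \<Sum>v\<in>vectors_ending_in j. a m (last_entry v) * weight a v)"
    by (simp only: weight_snoc sum_incr_vectors_by_last_entry)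
  also have "\<dots> = (\<Sum>j=0..m-1. a m j * (\<Sum>v\<in>vectors_ending_in j. weight a v))"
    by (simp add: sum_distrib_left vectors_ending_in_def)
  finally show ?thesis .
qed

lemma recursion_eq_weight_sum:
  fixes w :: "nat \<Rightarrow> 'a::comm_semiring_1"
  assumes w_rec: "\<And>m. m \<ge> 1 \<Longrightarrow> w m = (\<Sum>j=0..m-1. a m j * w j)"
  shows "w m = w 0 * (\<Sum>v\<in>vectors_ending_in m. weight a v)"
proof (induction m rule: less_induct)
  case (less m)
  show ?case
  proof (cases "m = 0")
    case True
    then show ?thesis
      by (simp add: vectors_ending_in_0)
  next
    case False
    then have "m \<ge> 1"
      by simp
    then have "w m = (\<Sum>j=0..m-1. a m j * w j)"
      by (rule w_rec)
    also have "\<dots> = (\<Sum>j=0..m-1. a m j * (w 0 * (\<Sum>v\<in>vectors_ending_in j. weight a v)))"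
    proof (rule sum.cong[OF refl])
      fix j assume "j \<in> {0..m-1}"
      with \<open>m \<ge> 1\<close> have "j < m"
        by auto
      from less.IH[OF this]
      show "a m j * w j = a m j * (w 0 * (\<Sum>v\<in>vectors_ending_in j. weight a v))"
        by (rule arg_cong)
    qed
    also have "\<dots> = w 0 * (\<Sum>v\<in>vectors_ending_in m. weight a v)"
      by (simp only: weight_sum_recursion[OF \<open>m \<ge> 1\<close>] sum_distrib_left mult.left_commute)
    finally show ?thesis .
  qed
qed

theorem theorem2p3:
  fixes w0 :: complex
    and a :: "nat \<Rightarrow> nat \<Rightarrow> complex"
    and w :: "nat \<Rightarrow> complex"
    and n :: nat
  assumes w_0: "w 0 = w0"
    and w_rec: "\<And>m. m \<ge> 1 \<Longrightarrow> w m = (\<Sum>j=0..m-1. a m j * w j)"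
    and n: "n \<ge> 1"
  shows "(\<Sum>j=0..n. w j) =
    w0 * (\<Sum>v\<in>incr_vectors n. \<Prod>k=1..length v. a (entry v k) (entry v (k - 1)))"
proof -
  have "(\<Sum>j=0..n. w j) = (\<Sum>j=0..n. w0 * (\<Sum>v\<in>vectors_ending_in j. weight a v))"
    unfolding w_0[symmetric] by (intro sum.cong refl recursion_eq_weight_sum w_rec)
  also have "\<dots> = w0 * (\<Sum>v\<in>incr_vectors n. weight a v)"
    by (simp only: sum_incr_vectors_by_last_entry sum_distrib_left)
  finally show ?thesis
    by (simp only: weight_def)
qed

end
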